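(* The momentum equation (the macroscopic evolution equation for the speed field $v(x,t)$) derived from the linear feedback control law $$a_n(t) = k_s(\rho,v)\,[\,s_n(t)-s_n^*(t)\,] + k_v(\rho,v)\,[\,v_{n-1}(t)-v_n(t)\,],\qquad s_n^*(t)=\tau v_n(t)+L,$$ is given by the partial differential equation $$v_t + \bigl(v - k_v(\rho,v)\,s\bigr)\,v_x + \bigl(-s + v\tau + L\bigr)\,k_s(\rho,v) = 0 .$$
   Context: Microscopic side: vehicle $n-1$ is the immediate leader of vehicle $n$; $x_n(t)$, $v_n(t)=\dot x_n(t)$ and $a_n(t)=\dot v_n(t)$ are the position, speed and acceleration of vehicle $n$; $s_n(t)=x_{n-1}(t)-x_n(t)$ is its spacing; $s_n^*(t)$ is its desired spacing under the constant headway policy, with constants $\tau$ (desired headway) and $L$ (standstill distance). Macroscopic side: $\rho(x,t)>0$ is the traffic density, $v(x,t)$ the speed function and $s(x,t)=1/\rho(x,t)$ the spacing function, with mass conservation $\rho_t+(\rho v)_x=0$ (equivalently $s_t+vs_x=sv_x$). Subscripts $t,x$ on fields denote partial derivatives. The derivation passes from the microscopic law to the macroscopic equation by writing $v_n(t)=v(x_n(t),t)$ and $s_n(t)=s(x_n(t),t)$ with $v$ and $s$ sufficiently smooth, and using mass conservation. The resulting equation is a field equation which, coupled with mass conservation, forms the macroscopic traffic flow model. The feedback gains are, with $\rho_c$ the critical density, $v_f$ the free-flow speed, and constants denoted by the same letters $k_s,k_v$: $k_s(\rho,v)=0$ and $k_v(\rho,v)=0$ if $0<\rho\le\rho_c$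 and $v=v_f$; otherwise $k_s(\rho,v)=k_s$ and $k_v(\rho,v)=k_v$. *)

theory Defs
  imports "HOL-Analysis.Analysis"
begin

text \<open>Vehicles: \<open>x n t\<close> is the position of vehicle \<open>n\<close> at time \<open>t\<close>; vehicle \<open>n - 1\<close> is its leader.\<close>

definition speed :: "(int \<Rightarrow> real \<Rightarrow> real) \<Rightarrow> int \<Rightarrow> real \<Rightarrow> real" where
  "speed x n t = deriv (x n) t"

definition accel :: "(int \<Rightarrow> real \<Rightarrow> real) \<Rightarrow> int \<Rightarrow> real \<Rightarrow> real" where
  "accel x n t = deriv (speed x n) t"

definition spacing :: "(int \<Rightarrow> real \<Rightarrow> real) \<Rightarrow> int \<Rightarrow> real \<Rightarrow> real" where
  "spacing x n t = x (n - 1) t - x n t"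

definition desired_spacing ::
  "real \<Rightarrow> real \<Rightarrow> (int \<Rightarrow> real \<Rightarrow> real) \<Rightarrow> int \<Rightarrow> real \<Rightarrow> real" where
  "desired_spacing \<tau> L x n t = \<tau> * speed x n t + L"

text \<open>Both gains have the same form: \<open>k\<close> is the constant value taken outside free flow.\<close>

definition gain :: "real \<Rightarrow> real \<Rightarrow> real \<Rightarrow> real \<Rightarrow> real \<Rightarrow> real" where
  "gain \<rho>\<^sub>c v\<^sub>f k r w = (if 0 < r \<and> r \<le> \<rho>\<^sub>c \<and> w = v\<^sub>f then 0 else k)"

text \<open>Fields are curried, space first: \<open>f x t\<close>.\<close>

definition dx :: "(real \<Rightarrow> real \<Rightarrow> real) \<Rightarrow> real \<Rightarrow> real \<Rightarrow> real" where
  "dx f x t = deriv (\<lambda>y. f y t) x"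

definition dt :: "(real \<Rightarrow> real \<Rightarrow> real) \<Rightarrow> real \<Rightarrow> real \<Rightarrow> real" where
  "dt f x t = deriv (\<lambda>u. f x u) t"

definition C1_field :: "(real \<times> real) set \<Rightarrow> (real \<Rightarrow> real \<Rightarrow> real) \<Rightarrow> bool" where
  "C1_field D f \<longleftrightarrow>
     (\<exists>f' :: real \<times> real \<Rightarrow> (real \<times> real) \<Rightarrow>\<^sub>L real.
        (\<forall>p\<in>D. ((\<lambda>(x, t). f x t) has_derivative blinfun_apply (f' p)) (at p)) \<and>
        continuous_on D f')"

definition spacing_field :: "(real \<Rightarrow> real \<Rightarrow> real) \<Rightarrow> real \<Rightarrow> real \<Rightarrow> real" where
  "spacing_field \<rho> x t = 1 / \<rho> x t"

definition mass_conservation ::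
  "(real \<times> real) set \<Rightarrow> (real \<Rightarrow> real \<Rightarrow> real) \<Rightarrow> (real \<Rightarrow> real \<Rightarrow> real) \<Rightarrow> bool" where
  "mass_conservation D \<rho> v \<longleftrightarrow>
     (\<forall>(x, t)\<in>D. dt \<rho> x t + dx (\<lambda>y u. \<rho> y u * v y u) x t = 0)"

text \<open>
  Vehicle \<open>n\<close> is described by the fields during the time interval \<open>I\<close>: its speed and its
  spacing are the field values at its position. Nothing is imposed on the speed of the leader
  beyond what the spacing relation implies; demanding \<open>v\<^sub>n\<^sub>-\<^sub>1(t) = v (x\<^sub>n\<^sub>-\<^sub>1(t), t)\<close> as well would, given
  mass conservation, constrain the fields themselves.
\<close>

definition vehicle_in_flow ::
  "(real \<times> real) set \<Rightarrow> (real \<Rightarrow> real \<Rightarrow> real) \<Rightarrow> (real \<Rightarrow> real \<Rightarrow> real) \<Rightarrow>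
   real set \<Rightarrow> (int \<Rightarrow> real \<Rightarrow> real) \<Rightarrow> int \<Rightarrow> bool" where
  "vehicle_in_flow D \<rho> v I x n \<longleftrightarrow>
     (\<forall>t\<in>I. (x n t, t) \<in> D \<and>
            (x n has_real_derivative v (x n t) t) (at t) \<and>
            spacing x n t = spacing_field \<rho> (x n t) t)"

definition control_law ::
  "real \<Rightarrow> real \<Rightarrow> real \<Rightarrow> real \<Rightarrow> real \<Rightarrow> real \<Rightarrow>
   (real \<Rightarrow> real \<Rightarrow> real) \<Rightarrow> (real \<Rightarrow> real \<Rightarrow> real) \<Rightarrow>
   (int \<Rightarrow> real \<Rightarrow> real) \<Rightarrow> int \<Rightarrow> real \<Rightarrow> bool" where
  "control_law \<rho>\<^sub>c v\<^sub>f k\<^sub>s k\<^sub>v \<tau> L \<rho> v x n t \<longleftrightarrow>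
     accel x n t =
       gain \<rho>\<^sub>c v\<^sub>f k\<^sub>s (\<rho> (x n t) t) (v (x n t) t) * (spacing x n t - desired_spacing \<tau> L x n t) +
       gain \<rho>\<^sub>c v\<^sub>f k\<^sub>v (\<rho> (x n t) t) (v (x n t) t) * (speed x (n - 1) t - speed x n t)"

definition momentum_equation ::
  "real \<Rightarrow> real \<Rightarrow> real \<Rightarrow> real \<Rightarrow> real \<Rightarrow> real \<Rightarrow>
   (real \<Rightarrow> real \<Rightarrow> real) \<Rightarrow> (real \<Rightarrow> real \<Rightarrow> real) \<Rightarrow> real \<Rightarrow> real \<Rightarrow> bool" where
  "momentum_equation \<rho>\<^sub>c v\<^sub>f k\<^sub>s k\<^sub>v \<tau> L \<rho> v x t \<longleftrightarrow>
     dt v x t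
     + (v x t - gain \<rho>\<^sub>c v\<^sub>f k\<^sub>v (\<rho> x t) (v x t) * spacing_field \<rho> x t) * dx v x t
     + (- spacing_field \<rho> x t + v x t * \<tau> + L) * gain \<rho>\<^sub>c v\<^sub>f k\<^sub>s (\<rho> x t) (v x t) = 0"

end

theory Submission
  imports Defs
begin

text \<open>
  Along a vehicle path, differentiating \<open>v\<^sub>n = v (x\<^sub>n, t)\<close> gives \<open>a\<^sub>n = v\<^sub>t + v v\<^sub>x\<close>, and differentiating
  \<open>x\<^sub>n\<^sub>-\<^sub>1 = x\<^sub>n + s (x\<^sub>n, t)\<close> gives \<open>v\<^sub>n\<^sub>-\<^sub>1 - v\<^sub>n = s\<^sub>t + v s\<^sub>x\<close>, which is \<open>s v\<^sub>x\<close> by mass conservation.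
  Hence the control law at time \<open>t\<close> is the momentum equation at \<open>(x\<^sub>n, t)\<close>. For the field equation on
  all of \<open>D\<close> it remains to run a vehicle through every point of \<open>D\<close>: its path solves \<open>x' = v (x, t)\<close>,
  and Picard iteration applies because \<open>v\<close> is locally Lipschitz; its leader is put at distance \<open>s\<close>.
\<close>

section \<open>Derivatives of fields along vehicle paths\<close>

lemma C1_field_partials:
  assumes "C1_field D f" "(x, t) \<in> D"
  shows "((\<lambda>(y, u). f y u) has_derivative (\<lambda>h. dx f x t * fst h + dt f x t * snd h)) (at (x, t))"
    and "((\<lambda>y. f y t) has_real_derivative dx f x t) (at x)"
    and "(f x has_real_derivative dt f x t) (at t)"
proof -
  obtain f' where f': "((\<lambda>(y, u). f y u) has_derivative f') (at (x, t))"
    using assms unfolding C1_field_def by blast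
  interpret f': bounded_linear f'
    using f' by (rule has_derivative_bounded_linear)
  \<comment> \<open>By linearity the total derivative is fixed by its values on the two basis
    vectors; restricting \<open>f\<close> to lines of constant time and of constant position
    identifies these values with \<open>dx\<close> and \<open>dt\<close>.\<close>
  have lin: "f' h = f' (1, 0) * fst h + f' (0, 1) * snd h" for h
  proof -
    have "h = fst h *\<^sub>R (1, 0) + snd h *\<^sub>R (0, 1)"
      by (cases h) simp
    then have "f' h = f' (fst h *\<^sub>R (1, 0) + snd h *\<^sub>R (0, 1))"
      by simp
    also have "\<dots> = fst h *\<^sub>R f' (1, 0) + snd h *\<^sub>R f' (0, 1)"
      by (simp only: f'.add f'.scaleR)
    finally show ?thesis by (simp add: mult.commute)
  qed
  have "((\<lambda>y. (y, t)) has_derivative (\<lambda>h. (h, 0))) (at x)"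
    by (auto intro!: derivative_eq_intros)
  from has_derivative_compose[OF this f']
  have "((\<lambda>y. f y t) has_derivative (\<lambda>h. f' (h, 0))) (at x)" by simp
  moreover have "(\<lambda>h. f' (h, 0)) = (*) (f' (1, 0))"
    by (rule ext, subst lin) simp
  ultimately have x: "((\<lambda>y. f y t) has_real_derivative f' (1, 0)) (at x)"
    by (simp add: has_field_derivative_def)
  have "((\<lambda>u. (x, u)) has_derivative (\<lambda>h. (0, h))) (at t)"
    by (auto intro!: derivative_eq_intros)
  from has_derivative_compose[OF this f']
  have "(f x has_derivative (\<lambda>h. f' (0, h))) (at t)" by simp
  moreover have "(\<lambda>h. f' (0, h)) = (*) (f' (0, 1))"
    by (rule ext, subst lin) simp
  ultimately have t: "(f x has_real_derivative f' (0, 1)) (at t)"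
    by (simp add: has_field_derivative_def)
  have eq: "dx f x t = f' (1, 0)" "dt f x t = f' (0, 1)"
    unfolding dx_def dt_def using x t by (auto intro: DERIV_imp_deriv)
  show "((\<lambda>y. f y t) has_real_derivative dx f x t) (at x)"
    "(f x has_real_derivative dt f x t) (at t)"
    using x t eq by simp_all
  have "f' = (\<lambda>h. dx f x t * fst h + dt f x t * snd h)"
    unfolding eq by (rule ext) (rule lin)
  with f' show "((\<lambda>(y, u). f y u) has_derivative (\<lambda>h. dx f x t * fst h + dt f x t * snd h)) (at (x, t))"
    by simp
qed

lemma C1_field_along_path:
  assumes "C1_field D f" "(X t, t) \<in> D" "(X has_real_derivative c) (at t)"
  shows "((\<lambda>u. f (X u) u) has_real_derivative dx f (X t) t * c + dt f (X t) t) (at t)"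
proof -
  have "((\<lambda>u. (X u, u)) has_derivative (\<lambda>h. (c * h, h))) (at t)"
    using assms(3) by (auto intro!: derivative_eq_intros simp: has_field_derivative_def)
  from has_derivative_compose[OF this C1_field_partials(1)[OF assms(1,2)]]
  have "((\<lambda>u. f (X u) u) has_derivative (\<lambda>h. dx f (X t) t * (c * h) + dt f (X t) t * h)) (at t)"
    by simp
  moreover have "(\<lambda>h. dx f (X t) t * (c * h) + dt f (X t) t * h) = (*) (dx f (X t) t * c + dt f (X t) t)"
    by (auto simp: algebra_simps)
  ultimately show ?thesis
    by (simp add: has_field_derivative_def)
qed

text \<open>Expanding the flux by the product rule shows that the density has derivative
  \<open>- (dx v * \<rho>)\<close> along a path of speed \<open>v\<close>. The quotient rule then
  turns this into the growth rate of \<open>1 / \<rho>\<close>.\<close>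

lemma spacing_field_along_path:
  assumes \<rho>: "C1_field D \<rho>" and v: "C1_field D v" and pos: "\<rho> (X t) t > 0"
    and mass: "mass_conservation D \<rho> v" and D: "(X t, t) \<in> D"
    and X: "(X has_real_derivative v (X t) t) (at t)"
  shows "((\<lambda>u. spacing_field \<rho> (X u) u) has_real_derivative
           spacing_field \<rho> (X t) t * dx v (X t) t) (at t)"
proof -
  let ?x = "X t"
  have "((\<lambda>y. \<rho> y t * v y t) has_real_derivative dx \<rho> ?x t * v ?x t + dx v ?x t * \<rho> ?x t) (at ?x)"
    by (intro DERIV_mult C1_field_partials(2)[OF \<rho> D] C1_field_partials(2)[OF v D])
  then have "dx (\<lambda>y u. \<rho> y u * v y u) ?x t = dx \<rho> ?x t * v ?x t + dx v ?x t * \<rho> ?x t"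
    unfolding dx_def[of "\<lambda>y u. \<rho> y u * v y u"] by (rule DERIV_imp_deriv)
  with mass D have eq: "dx \<rho> ?x t * v ?x t + dt \<rho> ?x t = - (dx v ?x t * \<rho> ?x t)"
    unfolding mass_conservation_def by force
  have "((\<lambda>u. \<rho> (X u) u) has_real_derivative - (dx v ?x t * \<rho> ?x t)) (at t)"
    using C1_field_along_path[OF \<rho> D X] eq by simp
  then have "((\<lambda>u. 1 / \<rho> (X u) u) has_real_derivative
      (0 * \<rho> ?x t - 1 * - (dx v ?x t * \<rho> ?x t)) / (\<rho> ?x t * \<rho> ?x t)) (at t)"
    using pos by (intro DERIV_divide) auto
  moreover have "(0 * \<rho> ?x t - 1 * - (dx v ?x t * \<rho> ?x t)) / (\<rho> ?x t * \<rho> ?x t) =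
      spacing_field \<rho> ?x t * dx v ?x t"
    using pos by (simp add: spacing_field_def)
  ultimately show ?thesis
    by (simp only: spacing_field_def)
qed

lemma vehicle_in_flow_control_law_iff:
  assumes \<rho>: "C1_field D \<rho>" and v: "C1_field D v" and pos: "\<forall>(x, t)\<in>D. \<rho> x t > 0"
    and mass: "mass_conservation D \<rho> v"
    and flow: "vehicle_in_flow D \<rho> v I x n" and I: "open I" "t \<in> I"
  shows "control_law \<rho>\<^sub>c v\<^sub>f k\<^sub>s k\<^sub>v \<tau> L \<rho> v x n t \<longleftrightarrow>
         momentum_equation \<rho>\<^sub>c v\<^sub>f k\<^sub>s k\<^sub>v \<tau> L \<rho> v (x n t) t"
proof -
  have D: "(x n u, u) \<in> D" and X: "(x n has_real_derivative v (x n u) u) (at u)"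
    and s: "spacing x n u = spacing_field \<rho> (x n u) u" if "u \<in> I" for u
    using flow that unfolding vehicle_in_flow_def by auto
  have speed: "speed x n u = v (x n u) u" if "u \<in> I" for u
    unfolding speed_def using X[OF that] by (rule DERIV_imp_deriv)
  have "((\<lambda>u. v (x n u) u) has_real_derivative dx v (x n t) t * v (x n t) t + dt v (x n t) t) (at t)"
    by (rule C1_field_along_path[OF v D[OF I(2)] X[OF I(2)]])
  \<comment> \<open>Acceleration differentiates \<open>speed x n\<close> as a function of time, so
    agreement with \<open>v\<close> is needed near \<open>t\<close> and not only at
    \<open>t\<close>; this is where \<open>I\<close> being open enters.\<close>
  then have "(speed x n has_real_derivative dx v (x n t) t * v (x n t) t + dt v (x n t) t) (at t)"
    by (rule has_field_derivative_transform_within_open) (use I speed in auto)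
  then have accel: "accel x n t = dx v (x n t) t * v (x n t) t + dt v (x n t) t"
    unfolding accel_def by (rule DERIV_imp_deriv)
  \<comment> \<open>The leader's speed is not prescribed by the flow; it is read off from its
    position, which on \<open>I\<close> is \<open>x n\<close> plus the spacing field.\<close>
  have "((\<lambda>u. x n u + spacing_field \<rho> (x n u) u) has_real_derivative
      v (x n t) t + spacing_field \<rho> (x n t) t * dx v (x n t) t) (at t)"
    by (intro DERIV_add X I(2) spacing_field_along_path[OF \<rho> v _ mass]) (use pos D[OF I(2)] in auto)
  then have "(x (n - 1) has_real_derivative
      v (x n t) t + spacing_field \<rho> (x n t) t * dx v (x n t) t) (at t)"
    by (rule has_field_derivative_transform_within_open)
      (use I s in \<open>auto simp: spacing_def algebra_simps\<close>)
  then have leader: "speed x (n - 1) t = v (x n t) t + spacing_field \<rho> (x n t) t * dx v (x n t) t"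
    unfolding speed_def by (rule DERIV_imp_deriv)
  \<comment> \<open>Both sides contain the same two gain values, so these stay opaque: no case split
    on free flow occurs, and the equations differ only by rearrangement.\<close>
  show ?thesis
    unfolding control_law_def momentum_equation_def accel leader speed[OF I(2)] s[OF I(2)]
      desired_spacing_def
    by algebra
qed

section \<open>Local existence of vehicle paths\<close>

text \<open>On a short time interval the integral operator of the initial value problem is a
  contraction, and its Banach fixed point is the solution.\<close>

lemma picard_global_lipschitz:
  fixes w :: "real \<Rightarrow> real \<Rightarrow> real"
  assumes cont: "continuous_on UNIV (\<lambda>(y, t). w y t)"
    and lip: "\<And>y z t. \<bar>w y t - w z t\<bar> \<le> K * \<bar>y - z\<bar>"
  obtains h X where "h > 0" "X t0 = x0"
    "\<And>t. \<bar>t - t0\<bar> < h \<Longrightarrow> (X has_real_derivative w (X t) t) (at t)"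
proof -
  have K: "K \<ge> 0"
    using lip[of 0 0 1] by simp
  \<comment> \<open>The half-length is chosen to make the contraction factor \<open>h * K\<close> at
    most 1/2; adding 1 covers \<open>K = 0\<close>.\<close>
  define h where "h = 1 / (2 * (K + 1))"
  have h: "h > 0" "h * K \<le> 1 / 2"
    using K by (auto simp: h_def field_simps)
  define J where "J = {t0 - h..t0 + h}"
  \<comment> \<open>Clamping time to \<open>J\<close> turns functions on \<open>J\<close> into
    bounded continuous functions on the whole line, so that the fixed point theorem can be used on
    the type of such functions.\<close>
  define c where "c t = max (t0 - h) (min (t0 + h) t)" for t
  have cJ: "c t \<in> J" for t using h by (auto simp: c_def J_def)
  have c_id: "c t = t" if "t \<in> J" for t using that by (auto simp: c_def J_def)
  have t0J: "t0 \<in> J" using h by (simp add: J_def)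
  \<comment> \<open>The oriented integral from \<open>t0\<close> to \<open>t\<close>, based at the
    left end of \<open>J\<close> so that it is also correct for \<open>t < t0\<close>.\<close>
  define P where "P g t = integral {t0 - h..t} g - integral {t0 - h..t0} g" for g :: "real \<Rightarrow> real" and t
  define F where "F \<phi> t = x0 + P (\<lambda>s. w (apply_bcontfun \<phi> s) s) t"
    for \<phi> :: "real \<Rightarrow>\<^sub>C real" and t
  have F_deriv: "(F \<phi> has_real_derivative w (\<phi> t) t) (at t within J)" if "t \<in> J" for \<phi> t
  proof -
    have "continuous_on J (\<lambda>s. (\<lambda>(y, t). w y t) (apply_bcontfun \<phi> s, s))"
      by (intro continuous_on_compose2[OF cont] continuous_intros) auto
    then have "continuous_on J (\<lambda>s. w (apply_bcontfun \<phi> s) s)" by simp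
    then have "((\<lambda>u. integral {t0 - h..u} (\<lambda>s. w (apply_bcontfun \<phi> s) s)) has_real_derivative w (\<phi> t) t)
        (at t within J)"
      using that unfolding J_def by (intro integral_has_real_derivative)
    then show ?thesis
      unfolding F_def P_def by (auto intro!: derivative_eq_intros)
  qed
  have F_bcont: "(\<lambda>t. F \<phi> (c t)) \<in> bcontfun" for \<phi>
  proof -
    have contF: "continuous_on J (F \<phi>)"
      using F_deriv by (rule DERIV_continuous_on)
    have "continuous_on UNIV c" unfolding c_def by (intro continuous_intros)
    then have "continuous_on UNIV (\<lambda>t. F \<phi> (c t))"
      by (rule continuous_on_compose2[OF contF]) (use cJ in auto)
    moreover have "bounded (F \<phi> ` J)"
      by (intro compact_imp_bounded compact_continuous_image contF) (simp add: J_def)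
    then have "bounded (range (\<lambda>t. F \<phi> (c t)))"
      by (rule bounded_subset) (use cJ in auto)
    ultimately show ?thesis by (simp add: bcontfun_def)
  qed
  define T where "T \<phi> = Bcontfun (\<lambda>t. F \<phi> (c t))" for \<phi>
  have T: "apply_bcontfun (T \<phi>) = (\<lambda>t. F \<phi> (c t))" for \<phi>
    unfolding T_def by (rule Bcontfun_inverse[OF F_bcont])
  have contr: "dist (T \<phi>) (T \<psi>) \<le> 1 / 2 * dist \<phi> \<psi>" for \<phi> \<psi>
  proof (rule dist_bound)
    fix t
    define G where "G u = F \<phi> u - F \<psi> u" for u
    \<comment> \<open>The mean value inequality replaces an estimate of integrals: \<open>G\<close>
      vanishes at \<open>t0\<close>, and the Lipschitz condition bounds its derivative.\<close>
    have "norm (G (c t) - G t0) \<le> (K * dist \<phi> \<psi>) * norm (c t - t0)"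
    proof (rule field_differentiable_bound[where S = J and f = G])
      show "convex J" by (simp add: J_def)
      show "(G has_field_derivative w (\<phi> u) u - w (\<psi> u) u) (at u within J)" if "u \<in> J" for u
        unfolding G_def using that by (intro derivative_intros F_deriv)
      show "norm (w (\<phi> u) u - w (\<psi> u) u) \<le> K * dist \<phi> \<psi>" if "u \<in> J" for u
      proof -
        have "\<bar>w (\<phi> u) u - w (\<psi> u) u\<bar> \<le> K * dist (\<phi> u) (\<psi> u)"
          using lip[of "\<phi> u" u "\<psi> u"] by (simp add: dist_real_def)
        also have "\<dots> \<le> K * dist \<phi> \<psi>"
          by (intro mult_left_mono K dist_bounded)
        finally show ?thesis by simp
      qed
    qed (use cJ t0J in auto)
    also have "\<dots> \<le> (K * dist \<phi> \<psi>) * h"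
      using cJ[of t] K by (intro mult_left_mono) (auto simp: J_def)
    also have "\<dots> = (h * K) * dist \<phi> \<psi>"
      by simp
    also have "\<dots> \<le> 1 / 2 * dist \<phi> \<psi>"
      by (intro mult_right_mono h) simp
    finally show "dist (T \<phi> t) (T \<psi> t) \<le> 1 / 2 * dist \<phi> \<psi>"
      by (simp add: T G_def F_def P_def dist_real_def)
  qed
  have "\<exists>!\<phi>. T \<phi> = \<phi>"
    by (rule banach_fix_type[where c = "1/2"]) (use contr in auto)
  then obtain \<phi> where \<phi>: "T \<phi> = \<phi>" by blast
  have eq: "\<phi> t = F \<phi> t" if "t \<in> J" for t
    using fun_cong[OF T[of \<phi>], of t] that by (simp add: \<phi> c_id)
  show thesis
  proof
    show "h > 0" by (rule h)
    show "apply_bcontfun \<phi> t0 = x0"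
      using eq[OF t0J] by (simp add: F_def P_def)
    fix t assume "\<bar>t - t0\<bar> < h"
    then have t: "t \<in> {t0 - h<..<t0 + h}" by auto
    \<comment> \<open>Derivatives within the closed interval \<open>J\<close> are one-sided at its
      ends; passing to the open interval gives the full derivative.\<close>
    have "(F \<phi> has_real_derivative w (\<phi> t) t) (at t within {t0 - h<..<t0 + h})"
      using t by (intro DERIV_subset[OF F_deriv]) (auto simp: J_def)
    then have "(F \<phi> has_real_derivative w (\<phi> t) t) (at t)"
      by (simp only: at_within_open[OF t open_greaterThanLessThan])
    then show "(apply_bcontfun \<phi> has_real_derivative w (\<phi> t) t) (at t)"
      by (rule has_field_derivative_transform_within_open[where S = "{t0 - h<..<t0 + h}"])
        (use t eq in \<open>auto simp: J_def\<close>)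
  qed
qed

text \<open>A C1 field is Lipschitz in space only locally. Precomposing \<open>v\<close> with a
  retraction onto a compact box in \<open>D\<close> gives a global field \<open>w\<close> to which
  the previous existence result applies; for a short time the solution stays in the box, where
  \<open>w\<close> is \<open>v\<close>.\<close>

lemma C1_field_local_flow:
  assumes "open D" and v: "C1_field D v" and D: "(x0, t0) \<in> D"
  obtains h X where "h > 0" "X t0 = x0"
    "\<And>t. t \<in> {t0 - h<..<t0 + h} \<Longrightarrow> (X t, t) \<in> D \<and> (X has_real_derivative v (X t) t) (at t)"
proof -
  obtain A B where AB: "open A" "open B" "(x0, t0) \<in> A \<times> B" "A \<times> B \<subseteq> D"
    using open_prod_elim[OF \<open>open D\<close> D] by metis
  obtain r1 where r1: "r1 > 0" "cball x0 r1 \<subseteq> A"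
    using AB by (meson SigmaD1 open_contains_cball)
  obtain r2 where r2: "r2 > 0" "cball t0 r2 \<subseteq> B"
    using AB by (meson SigmaD2 open_contains_cball)
  let ?Q = "cball x0 r1 \<times> cball t0 r2"
  have QD: "?Q \<subseteq> D" using r1 r2 AB by blast
  have Q: "compact ?Q" "convex ?Q"
    by (auto intro: compact_Times convex_Times)
  obtain v' :: "real \<times> real \<Rightarrow> (real \<times> real) \<Rightarrow>\<^sub>L real" where
    v': "\<And>p. p \<in> D \<Longrightarrow> ((\<lambda>(x, t). v x t) has_derivative blinfun_apply (v' p)) (at p)"
      "continuous_on D v'"
    using v unfolding C1_field_def by blast
  \<comment> \<open>The Lipschitz constant is a bound for the continuous derivative on the compact
    box; convexity of the box then allows the mean value inequality.\<close>
  have "compact (v' ` ?Q)"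
    by (intro compact_continuous_image continuous_on_subset[OF v'(2)] QD Q)
  then obtain K where K: "\<And>p. p \<in> ?Q \<Longrightarrow> norm (v' p) \<le> K"
    by (meson bounded_iff compact_imp_bounded imageI)
  have K0: "K \<ge> 0"
    using K[of "(x0, t0)"] r1 r2 by (intro order_trans[OF norm_ge_zero]) auto
  have lip: "\<bar>v y t - v z t\<bar> \<le> K * \<bar>y - z\<bar>"
    if "y \<in> cball x0 r1" "z \<in> cball x0 r1" "t \<in> cball t0 r2" for y z t
  proof -
    have "norm ((\<lambda>(x, t). v x t) (y, t) - (\<lambda>(x, t). v x t) (z, t)) \<le> K * norm ((y, t) - (z, t))"
    proof (rule differentiable_bound[OF Q(2)])
      show "((\<lambda>(x, t). v x t) has_derivative blinfun_apply (v' p)) (at p within ?Q)" if "p \<in> ?Q" for p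
        using that QD by (intro has_derivative_at_withinI[OF v'(1)]) blast
      show "onorm (blinfun_apply (v' p)) \<le> K" if "p \<in> ?Q" for p
        using K[OF that] by (simp add: norm_blinfun.rep_eq)
    qed (use that in auto)
    then show ?thesis by simp
  qed
  define p where "p m r y = max (m - r) (min (m + r) y)" for m r y :: real
  have p_mem: "p m r y \<in> cball m r" if "r > 0" for m r y
    using that by (auto simp: p_def dist_real_def)
  have p_id: "p m r y = y" if "y \<in> cball m r" for m r y
    using that by (auto simp: p_def dist_real_def abs_le_iff)
  have p_lip: "\<bar>p m r y - p m r z\<bar> \<le> \<bar>y - z\<bar>" for m r y z
    by (auto simp: p_def max_def min_def)
  define w where "w y t = v (p x0 r1 y) (p t0 r2 t)" for y t
  have "continuous_on D (\<lambda>(x, t). v x t)"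
    by (rule has_derivative_continuous_on[OF has_derivative_at_withinI[OF v'(1)]])
  then have "continuous_on UNIV (\<lambda>q. (\<lambda>(x, t). v x t) (p x0 r1 (fst q), p t0 r2 (snd q)))"
  proof (rule continuous_on_compose2)
    show "continuous_on UNIV (\<lambda>q. (p x0 r1 (fst q), p t0 r2 (snd q)))"
      unfolding p_def by (intro continuous_intros)
    show "range (\<lambda>q. (p x0 r1 (fst q), p t0 r2 (snd q))) \<subseteq> D"
      using QD p_mem r1 r2 by blast
  qed
  then have w_cont: "continuous_on UNIV (\<lambda>(y, t). w y t)"
    by (simp add: w_def case_prod_unfold)
  have w_lip: "\<bar>w y t - w z t\<bar> \<le> K * \<bar>y - z\<bar>" for y z t
  proof -
    have "\<bar>w y t - w z t\<bar> \<le> K * \<bar>p x0 r1 y - p x0 r1 z\<bar>"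
      unfolding w_def by (intro lip p_mem r1 r2)
    also have "\<dots> \<le> K * \<bar>y - z\<bar>"
      by (intro mult_left_mono p_lip K0)
    finally show ?thesis .
  qed
  obtain h X where h: "h > 0" and X0: "X t0 = x0"
    and X: "\<And>t. \<bar>t - t0\<bar> < h \<Longrightarrow> (X has_real_derivative w (X t) t) (at t)"
    using picard_global_lipschitz[OF w_cont w_lip] by metis
  have "isCont X t0"
    using X[of t0] h by (auto intro: DERIV_isCont)
  then obtain d where d: "d > 0" "\<And>t. dist t t0 < d \<Longrightarrow> dist (X t) (X t0) < r1"
    unfolding continuous_at_eps_delta using r1(1) by blast
  show thesis
  proof
    \<comment> \<open>\<open>h\<close> keeps the differential equation for \<open>w\<close>,
      \<open>d\<close> keeps the position in the box, and \<open>r2\<close> keeps the time in the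
      box.\<close>
    show "min h (min d r2) > 0" using h d r2 by simp
    show "X t0 = x0" by (rule X0)
    fix t assume "t \<in> {t0 - min h (min d r2)<..<t0 + min h (min d r2)}"
    then have t: "\<bar>t - t0\<bar> < h" "dist t t0 < d" "t \<in> cball t0 r2"
      by (auto simp: dist_real_def abs_less_iff)
    moreover have "X t \<in> cball x0 r1"
      using d(2)[OF t(2)] X0 by (simp add: dist_commute)
    ultimately show "(X t, t) \<in> D \<and> (X has_real_derivative v (X t) t) (at t)"
      using X[OF t(1)] QD by (auto simp: w_def p_id)
  qed
qed

lemma vehicle_in_flow_exists:
  assumes "open D" "C1_field D v" "(x0, t0) \<in> D"
  obtains h x where "h > 0" "x 0 t0 = x0" "vehicle_in_flow D \<rho> v {t0 - h<..<t0 + h} x 0"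
proof -
  obtain h X where h: "h > 0" "X t0 = x0"
    and X: "\<And>t. t \<in> {t0 - h<..<t0 + h} \<Longrightarrow> (X t, t) \<in> D \<and> (X has_real_derivative v (X t) t) (at t)"
    using C1_field_local_flow[OF assms] by metis
  \<comment> \<open>Only the indices 0 and -1 enter the flow condition for vehicle 0, so every other
    index is simply given the leader's path.\<close>
  define x :: "int \<Rightarrow> real \<Rightarrow> real"
    where "x n = (if n = 0 then X else (\<lambda>t. X t + spacing_field \<rho> (X t) t))" for n
  show thesis
  proof
    show "vehicle_in_flow D \<rho> v {t0 - h<..<t0 + h} x 0"
      using X by (simp add: vehicle_in_flow_def x_def spacing_def)
  qed (use h in \<open>auto simp: x_def\<close>)
qed

section \<open>From vehicle paths to the field equation\<close>

theorem proposition1: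
  fixes D :: "(real \<times> real) set"
    and \<rho> v :: "real \<Rightarrow> real \<Rightarrow> real"
    and \<rho>\<^sub>c v\<^sub>f k\<^sub>s k\<^sub>v \<tau> L :: real
  assumes "open D"
    and "C1_field D \<rho>"
    and "C1_field D v"
    and "\<forall>(x, t)\<in>D. \<rho> x t > 0"
    and "mass_conservation D \<rho> v"
  shows "(\<forall>x n a b. vehicle_in_flow D \<rho> v {a<..<b} x n \<longrightarrow>
             (\<forall>t\<in>{a<..<b}. control_law \<rho>\<^sub>c v\<^sub>f k\<^sub>s k\<^sub>v \<tau> L \<rho> v x n t \<longleftrightarrow>
                           momentum_equation \<rho>\<^sub>c v\<^sub>f k\<^sub>s k\<^sub>v \<tau> L \<rho> v (x n t) t))
       \<and> ((\<forall>x n a b. vehicle_in_flow D \<rho> v {a<..<b} x n \<longrightarrow>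
             (\<forall>t\<in>{a<..<b}. control_law \<rho>\<^sub>c v\<^sub>f k\<^sub>s k\<^sub>v \<tau> L \<rho> v x n t))
          \<longleftrightarrow> (\<forall>(x, t)\<in>D. momentum_equation \<rho>\<^sub>c v\<^sub>f k\<^sub>s k\<^sub>v \<tau> L \<rho> v x t))"
    (is "?pointwise \<and> (?law \<longleftrightarrow> ?field)")
proof -
  have iff: "control_law \<rho>\<^sub>c v\<^sub>f k\<^sub>s k\<^sub>v \<tau> L \<rho> v x n t \<longleftrightarrow>
      momentum_equation \<rho>\<^sub>c v\<^sub>f k\<^sub>s k\<^sub>v \<tau> L \<rho> v (x n t) t"
    if "vehicle_in_flow D \<rho> v {a<..<b} x n" "t \<in> {a<..<b}" for x n a b t
    by (rule vehicle_in_flow_control_law_iff[OF assms(2-5) that(1) open_greaterThanLessThan that(2)])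
  \<comment> \<open>The law is assumed for every vehicle in the flow, so it holds for the one
    constructed through the given point, and there it yields the momentum equation.\<close>
  have "?field" if law: ?law
  proof clarify
    fix x0 t0 assume "(x0, t0) \<in> D"
    then obtain h x where x: "h > 0" "x 0 t0 = x0" "vehicle_in_flow D \<rho> v {t0 - h<..<t0 + h} x 0"
      using vehicle_in_flow_exists[OF assms(1,3)] by metis
    then have "t0 \<in> {t0 - h<..<t0 + h}" by simp
    with x law iff show "momentum_equation \<rho>\<^sub>c v\<^sub>f k\<^sub>s k\<^sub>v \<tau> L \<rho> v x0 t0" by blast
  qed
  \<comment> \<open>Conversely, a vehicle in the flow stays in \<open>D\<close>, so the field
    equation is available at each point of its path.\<close>
  moreover have "?law" if field: ?field
  proof (intro allI impI ballI)
    fix x n a b t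
    assume flow: "vehicle_in_flow D \<rho> v {a<..<b} x n" and t: "t \<in> {a<..<b}"
    then have "(x n t, t) \<in> D" unfolding vehicle_in_flow_def by blast
    with field iff[OF flow t] show "control_law \<rho>\<^sub>c v\<^sub>f k\<^sub>s k\<^sub>v \<tau> L \<rho> v x n t" by blast
  qed
  ultimately show ?thesis using iff by blast
qed

end
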